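(* Let $J$ be an almost complex structure on a real $3$-Bihom-Lie algebra $(L,[\cdot,\cdot,\cdot],\alpha,\beta)$. If $$J[x,y,z]=[Jx,y,z]\quad\text{for all }x,y,z\in L,$$ then $J$ is a complex structure on $L$.
   Context: A real $3$-Bihom-Lie algebra is a $4$-tuple $(L,[\cdot,\cdot,\cdot],\alpha,\beta)$ consisting of a real vector space $L$, a $3$-linear map $[\cdot,\cdot,\cdot]\colon L\times L\times L\to L$ and two linear maps $\alpha,\beta\colon L\to L$ such that for all $x,y,z,u,v\in L$: (1) $\alpha\beta=\beta\alpha$; (2) $\alpha([x,y,z])=[\alpha(x),\alpha(y),\alpha(z)]$ and $\beta([x,y,z])=[\beta(x),\beta(y),\beta(z)]$; (3) $[\beta(x),\beta(y),\alpha(z)]=-[\beta(y),\beta(x),\alpha(z)]=-[\beta(x),\beta(z),\alpha(y)]$; (4) $[\beta^2(u),\beta^2(v),[\beta(x),\beta(y),\alpha(z)]]=[\beta^2(y),\beta^2(z),[\beta(u),\beta(v),\alpha(x)]]-[\beta^2(x),\beta^2(z),[\beta(u),\beta(v),\alpha(y)]]+[\beta^2(x),\beta^2(y),[\beta(u),\beta(v),\alpha(z)]]$. An almost complex structure on $L$ is a linear map $J\colon L\to L$ with $J^2=-\mathrm{Id}$, $J\alpha=\alpha J$ and $J\beta=\beta J$. It is a complex structure if for all $x,y,z\in L$, $$J[x,y,z]=-[Jx,Jy,Jz]+[Jx,y,z]+[x,Jy,z]+[x,y,Jz]+J[Jx,Jy,z]+J[x,Jy,Jz]+J[Jx,y,Jz].$$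 *)

theory Defs
  imports Complex_Main
begin

definition trilinear :: "('a::real_vector \<Rightarrow> 'a \<Rightarrow> 'a \<Rightarrow> 'a) \<Rightarrow> bool" where
  "trilinear f \<longleftrightarrow>
     (\<forall>y z. linear (\<lambda>x. f x y z)) \<and>
     (\<forall>x z. linear (\<lambda>y. f x y z)) \<and>
     (\<forall>x y. linear (\<lambda>z. f x y z))"

text \<open>The underlying vector space is the whole type; \<open>br x y z\<close> is the bracket \<open>[x, y, z]\<close>.\<close>

locale three_bihom_lie_algebra =
  fixes br :: "'a::real_vector \<Rightarrow> 'a \<Rightarrow> 'a \<Rightarrow> 'a"
    and \<alpha> \<beta> :: "'a \<Rightarrow> 'a"
  assumes trilinear_br: "trilinear br"
    and linear_alpha: "linear \<alpha>"
    and linear_beta: "linear \<beta>"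
    and alpha_beta_commute: "\<alpha> \<circ> \<beta> = \<beta> \<circ> \<alpha>"
    and alpha_br: "\<alpha> (br x y z) = br (\<alpha> x) (\<alpha> y) (\<alpha> z)"
    and beta_br: "\<beta> (br x y z) = br (\<beta> x) (\<beta> y) (\<beta> z)"
    and bihom_skew_12: "br (\<beta> x) (\<beta> y) (\<alpha> z) = - br (\<beta> y) (\<beta> x) (\<alpha> z)"
    and bihom_skew_23: "br (\<beta> x) (\<beta> y) (\<alpha> z) = - br (\<beta> x) (\<beta> z) (\<alpha> y)"
    and bihom_jacobi:
      "br (\<beta> (\<beta> u)) (\<beta> (\<beta> v)) (br (\<beta> x) (\<beta> y) (\<alpha> z)) =
         br (\<beta> (\<beta> y)) (\<beta> (\<beta> z)) (br (\<beta> u) (\<beta> v) (\<alpha> x))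
       - br (\<beta> (\<beta> x)) (\<beta> (\<beta> z)) (br (\<beta> u) (\<beta> v) (\<alpha> y))
       + br (\<beta> (\<beta> x)) (\<beta> (\<beta> y)) (br (\<beta> u) (\<beta> v) (\<alpha> z))"

locale almost_complex_structure = three_bihom_lie_algebra br \<alpha> \<beta>
  for br :: "'a::real_vector \<Rightarrow> 'a \<Rightarrow> 'a \<Rightarrow> 'a" and \<alpha> \<beta> :: "'a \<Rightarrow> 'a" +
  fixes J :: "'a \<Rightarrow> 'a"
  assumes linear_J: "linear J"
    and J_squared: "J \<circ> J = (\<lambda>x. - x)"
    and J_alpha_commute: "J \<circ> \<alpha> = \<alpha> \<circ> J"
    and J_beta_commute: "J \<circ> \<beta> = \<beta> \<circ> J"

locale complex_structure = almost_complex_structure br \<alpha> \<beta> J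
  for br :: "'a::real_vector \<Rightarrow> 'a \<Rightarrow> 'a \<Rightarrow> 'a" and \<alpha> \<beta> J :: "'a \<Rightarrow> 'a" +
  assumes integrability:
    "J (br x y z) =
       - br (J x) (J y) (J z) + br (J x) y z + br x (J y) z + br x y (J z)
       + J (br (J x) (J y) z) + J (br x (J y) (J z)) + J (br (J x) y (J z))"

end

theory Submission
  imports Defs
begin

text \<open>Pulling \<open>J\<close> out of the first slot and using \<open>J (J x) = - x\<close>
  turns \<open>J (br (J x) (J y) z)\<close> into \<open>- br x (J y) z\<close> and
  \<open>J (br (J x) y (J z))\<close> into \<open>- br x y (J z)\<close>, while
  \<open>J (br x (J y) (J z))\<close> equals \<open>br (J x) (J y) (J z)\<close>. Everything cancels
  but \<open>br (J x) y z\<close>.\<close>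

theorem proposition4p6:
  fixes br :: "'a::real_vector \<Rightarrow> 'a \<Rightarrow> 'a \<Rightarrow> 'a"
    and \<alpha> \<beta> J :: "'a \<Rightarrow> 'a"
  assumes "three_bihom_lie_algebra br \<alpha> \<beta>"
    and "almost_complex_structure br \<alpha> \<beta> J"
    and "\<And>x y z. J (br x y z) = br (J x) y z"
  shows "complex_structure br \<alpha> \<beta> J"
proof -
  interpret almost_complex_structure br \<alpha> \<beta> J by fact
  have JJ: "J (J x) = - x" for x
    using J_squared by (simp add: fun_eq_iff)
  show ?thesis
    \<comment> \<open>Only \<open>integrability\<close> remains. The hypothesis is reversed so that
      rewriting moves \<open>J\<close> outwards, where squares of \<open>J\<close> meet
      \<open>JJ\<close>.\<close>
    by unfold_locales (simp add: assms(3)[symmetric] JJ)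
qed

end
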